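(* Let $H$ be a complex Hilbert space, let $A\in\mathcal{B}(H)$ be positive, and let $T:\mathcal{D}(T)\subseteq H\to H$ be a densely defined closable linear operator. Suppose that the $A$-adjoint $T^{\#}$ exists and is densely defined. Then $T$ is $A$-bounded if and only if $T^{\#}$ is $A$-bounded. Moreover, their $A$-bounds are equal, that is, $\|T\|_A=\|T^{\#}\|_A$.
   Context: Inner products are linear in the first variable. For a positive bounded operator $A$ on $H$, $\langle f,g\rangle_A=\langle Af,g\rangle$ and $\|f\|_A=\langle Af,f\rangle^{1/2}$. $\mathcal{D}(\cdot)$ and $\mathcal{R}(\cdot)$ denote domain and range. A linear operator $T:\mathcal{D}(T)\subseteq H\to H$ is $A$-bounded if there is $c\ge 0$ with $\|Tf\|_A\le c\|f\|_A$ for all $f\in\mathcal{D}(T)$; the least such $c$ is denoted $\|T\|_A$. $A$-adjoint: let $T:\mathcal{D}(T)\subseteq H\to H$ be densely defined and closable with $\mathcal{R}(T^*A)\subseteq\mathcal{R}(A)$, where $T^*$ is the Hilbert-space adjoint (in this case one says $T^{\#}$ exists). The $A$-adjoint $T^{\#}$ has domain the set of $f\in H$ for which there is a unique $g_f\in\overline{\mathcal{R}(A)}$ with $\langle Th,f\rangle_A=\langle h,g_f\rangle_A$ for every $h\in\mathcal{D}(T)$, and $T^{\#}f=g_f$. It is the unique operator with $AT^{\#}=T^*A$ (equality including domains) and $\mathcal{R}(T^{\#})\subseteq\overline{\mathcal{R}(A)}$. *)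

theory Defs
  imports "HOL-Analysis.Analysis"
begin

section \<open>Complex Hilbert spaces\<close>

text \<open>
  The complex structure is put on top of \<^class>\<open>real_inner\<close>, so that norm and topology are the
  library ones; \<open>inner_eq_Re_cinner\<close> says that they are those of the complex inner product, which
  is linear in its first argument. Positive definiteness of \<open>cinner\<close> follows from that of \<open>inner\<close>.
\<close>

class complex_inner = real_inner +
  fixes scaleC :: "complex \<Rightarrow> 'a \<Rightarrow> 'a" (infixr "*\<^sub>C" 75)
    and cinner :: "'a \<Rightarrow> 'a \<Rightarrow> complex"
  assumes scaleC_add_right: "a *\<^sub>C (x + y) = a *\<^sub>C x + a *\<^sub>C y"
    and scaleC_add_left: "(a + b) *\<^sub>C x = a *\<^sub>C x + b *\<^sub>C x"
    and scaleC_scaleC: "a *\<^sub>C b *\<^sub>C x = (a * b) *\<^sub>C x"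
    and scaleC_one: "1 *\<^sub>C x = x"
    and scaleR_scaleC: "r *\<^sub>R x = complex_of_real r *\<^sub>C x"
    and cinner_commute: "cinner x y = cnj (cinner y x)"
    and cinner_add_left: "cinner (x + y) z = cinner x z + cinner y z"
    and cinner_scaleC_left: "cinner (a *\<^sub>C x) y = a * cinner x y"
    and inner_eq_Re_cinner: "inner x y = Re (cinner x y)"

class complex_hilbert_space = complex_inner + complete_space

global_interpretation complex_vector:
  vector_space "scaleC :: complex \<Rightarrow> 'a \<Rightarrow> 'a::complex_inner"
  by unfold_locales (simp_all add: scaleC_add_right scaleC_add_left scaleC_scaleC scaleC_one)

instantiation complex :: complex_hilbert_space
begin

definition scaleC_complex :: "complex \<Rightarrow> complex \<Rightarrow> complex"
  where "scaleC_complex a x = a * x"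

definition cinner_complex :: "complex \<Rightarrow> complex \<Rightarrow> complex"
  where "cinner_complex x y = x * cnj y"

instance
  by standard
    (simp_all add: scaleC_complex_def cinner_complex_def algebra_simps scaleR_conv_of_real
      inner_complex_def)

end


section \<open>Positive bounded operators and the semi-inner product they induce\<close>

definition bounded_clinear :: "('a::complex_inner \<Rightarrow> 'a) \<Rightarrow> bool"
  where "bounded_clinear A \<longleftrightarrow>
    Vector_Spaces.linear scaleC scaleC A \<and> (\<exists>K. \<forall>x. norm (A x) \<le> K * norm x)"

definition positive_op :: "('a::complex_inner \<Rightarrow> 'a) \<Rightarrow> bool"
  where "positive_op A \<longleftrightarrow> (\<forall>x. cinner (A x) x \<in> \<real>\<^sub>\<ge>\<^sub>0)"

definition A_inner :: "('a::complex_inner \<Rightarrow> 'a) \<Rightarrow> 'a \<Rightarrow> 'a \<Rightarrow> complex"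
  where "A_inner A f g = cinner (A f) g"

text \<open>For positive \<open>A\<close> the number \<open>A_inner A f f\<close> is real and nonnegative.\<close>

definition A_norm :: "('a::complex_inner \<Rightarrow> 'a) \<Rightarrow> 'a \<Rightarrow> real"
  where "A_norm A f = sqrt (Re (A_inner A f f))"


section \<open>Unbounded operators\<close>

text \<open>
  An operator with its domain is a partial function \<open>T :: 'a \<rightharpoonup> 'a\<close>: its domain is \<open>dom T\<close>, its
  range \<open>ran T\<close>, and its value at \<open>f \<in> dom T\<close> is \<open>the (T f)\<close>. The product \<open>S \<circ>\<^sub>m T\<close> then has the
  usual domain, those \<open>f \<in> dom T\<close> whose value lies in \<open>dom S\<close>. An everywhere defined
  \<open>A :: 'a \<Rightarrow> 'a\<close> becomes \<open>Some \<circ> A\<close>.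
\<close>

definition linear_operator :: "('a::complex_inner \<rightharpoonup> 'a) \<Rightarrow> bool"
  where "linear_operator T \<longleftrightarrow>
    complex_vector.subspace (dom T) \<and>
    (\<forall>f\<in>dom T. \<forall>g\<in>dom T. the (T (f + g)) = the (T f) + the (T g)) \<and>
    (\<forall>a. \<forall>f\<in>dom T. the (T (a *\<^sub>C f)) = a *\<^sub>C the (T f))"

definition densely_defined :: "('a::complex_inner \<rightharpoonup> 'a) \<Rightarrow> bool"
  where "densely_defined T \<longleftrightarrow> closure (dom T) = UNIV"

definition closable :: "('a::complex_inner \<rightharpoonup> 'a) \<Rightarrow> bool"
  where "closable T \<longleftrightarrow> (\<exists>S. linear_operator S \<and> T \<subseteq>\<^sub>m S \<and> closed (Map.graph S))"

text \<open>
  Hilbert space adjoint. When \<open>T\<close> is densely defined the vector \<open>g\<close> is unique as soon as it exists,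
  so that the domain is the usual one.
\<close>

definition adjoint_op :: "('a::complex_inner \<rightharpoonup> 'a) \<Rightarrow> ('a \<rightharpoonup> 'a)"
  where "adjoint_op T = (\<lambda>f.
    if \<exists>!g. \<forall>h\<in>dom T. cinner (the (T h)) f = cinner h g
    then Some (THE g. \<forall>h\<in>dom T. cinner (the (T h)) f = cinner h g)
    else None)"


section \<open>The \<open>A\<close>-adjoint and \<open>A\<close>-boundedness\<close>

definition A_adjoint_exists :: "('a::complex_inner \<Rightarrow> 'a) \<Rightarrow> ('a \<rightharpoonup> 'a) \<Rightarrow> bool"
  where "A_adjoint_exists A T \<longleftrightarrow> ran (adjoint_op T \<circ>\<^sub>m (Some \<circ> A)) \<subseteq> range A"

definition A_adjoint :: "('a::complex_inner \<Rightarrow> 'a) \<Rightarrow> ('a \<rightharpoonup> 'a) \<Rightarrow> ('a \<rightharpoonup> 'a)"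
  where "A_adjoint A T = (\<lambda>f.
    if \<exists>!g. g \<in> closure (range A) \<and> (\<forall>h\<in>dom T. A_inner A (the (T h)) f = A_inner A h g)
    then Some (THE g. g \<in> closure (range A) \<and>
      (\<forall>h\<in>dom T. A_inner A (the (T h)) f = A_inner A h g))
    else None)"

definition A_bounded_by :: "('a::complex_inner \<Rightarrow> 'a) \<Rightarrow> ('a \<rightharpoonup> 'a) \<Rightarrow> real \<Rightarrow> bool"
  where "A_bounded_by A T c \<longleftrightarrow>
    0 \<le> c \<and> (\<forall>f\<in>dom T. A_norm A (the (T f)) \<le> c * A_norm A f)"

definition A_bounded :: "('a::complex_inner \<Rightarrow> 'a) \<Rightarrow> ('a \<rightharpoonup> 'a) \<Rightarrow> bool"
  where "A_bounded A T \<longleftrightarrow> (\<exists>c. A_bounded_by A T c)"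

text \<open>Meaningful only when \<open>A_bounded A T\<close> holds; the least such constant then exists.\<close>

definition A_bound :: "('a::complex_inner \<Rightarrow> 'a) \<Rightarrow> ('a \<rightharpoonup> 'a) \<Rightarrow> real"
  where "A_bound A T = (LEAST c. A_bounded_by A T c)"

end

theory Submission
  imports Defs
begin

text \<open>
  For \<open>h \<in> dom T\<close> and \<open>f \<in> dom T\<^sup>#\<close> one has \<open>\<langle>T h, f\<rangle>\<^sub>A = \<langle>h, T\<^sup># f\<rangle>\<^sub>A\<close>. If \<open>T\<close> is \<open>A\<close>-bounded by \<open>c\<close>, then
  \<open>\<langle>h, T\<^sup># f\<rangle>\<^sub>A \<le> c \<parallel>h\<parallel>\<^sub>A \<parallel>f\<parallel>\<^sub>A\<close> for \<open>h \<in> dom T\<close>, hence by density for all \<open>h\<close>, and \<open>h = T\<^sup># f\<close> gives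
  the bound \<open>c\<close> for \<open>T\<^sup>#\<close>. The argument is symmetric in the two operators because both domains are
  dense, so they have the same set of admissible constants. Real parts of the inner products
  suffice throughout.
\<close>

text \<open>Makes imaginary parts of \<open>cinner\<close> accessible through the real inner
  product.\<close>

lemma inner_scaleC_ii_left: "inner (\<i> *\<^sub>C x) y = - Im (cinner x y)"
  for x y :: "'a::complex_inner"
  by (simp add: inner_eq_Re_cinner cinner_scaleC_left)

lemma inner_scaleC_ii_scaleC_ii: "inner (\<i> *\<^sub>C x) (\<i> *\<^sub>C y) = inner x y"
  for x y :: "'a::complex_inner"
proof -
  have "inner (\<i> *\<^sub>C x) (\<i> *\<^sub>C y) = Im (cinner (\<i> *\<^sub>C y) x)"
    using cinner_commute[of x "\<i> *\<^sub>C y"] by (simp add: inner_scaleC_ii_left)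
  also have "\<dots> = inner y x"
    by (simp add: cinner_scaleC_left inner_eq_Re_cinner)
  finally show ?thesis by (simp add: inner_commute)
qed

lemma bounded_clinear_imp_bounded_linear:
  assumes "bounded_clinear A"
  shows "bounded_linear A"
proof -
  from assms obtain K where lin: "Vector_Spaces.linear scaleC scaleC A"
    and K: "norm (A x) \<le> K * norm x" for x
    unfolding bounded_clinear_def by blast
  interpret A: Vector_Spaces.linear scaleC scaleC A by (rule lin)
  show ?thesis
    by (rule bounded_linear_intro[where K = K])
      (simp_all add: A.add A.scale scaleR_scaleC K mult.commute)
qed

lemma A_norm_eq_sqrt_inner: "A_norm A f = sqrt (inner (A f) f)"
  by (simp add: A_norm_def A_inner_def inner_eq_Re_cinner)

lemma positive_op_inner_nonneg:
  assumes "positive_op A"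
  shows "0 \<le> inner (A f) f"
  using assms unfolding positive_op_def inner_eq_Re_cinner complex_nonneg_Reals_iff by blast

text \<open>Polarization over the complex scalars: \<langle>A x, x\<rangle> is real, so the cross
  terms of its imaginary part at \<open>f + u\<close> cancel; the choice u = \<i> g turns this into
  symmetry of the real parts.\<close>

lemma positive_op_inner_commute:
  assumes "bounded_clinear A" and "positive_op A"
  shows "inner (A f) g = inner (A g) f"
proof -
  interpret A: Vector_Spaces.linear scaleC scaleC A
    using assms(1) unfolding bounded_clinear_def by blast
  have real: "inner (\<i> *\<^sub>C A x) x = 0" for x
    using assms(2) unfolding positive_op_def complex_nonneg_Reals_iff
    by (simp add: inner_scaleC_ii_left)
  have polar: "inner (\<i> *\<^sub>C A f) u + inner (\<i> *\<^sub>C A u) f = 0" for u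
    using real[of "f + u"] real[of f] real[of u]
    by (simp add: A.add scaleC_add_right inner_add_left inner_add_right)
  have "\<i> *\<^sub>C A (\<i> *\<^sub>C g) = (\<i> * \<i>) *\<^sub>C A g"
    by (simp only: A.scale scaleC_scaleC)
  also have "\<dots> = - A g"
    by (simp add: scaleC_one complex_vector.scale_minus_left)
  finally show ?thesis
    using polar[of "\<i> *\<^sub>C g"] by (simp add: inner_scaleC_ii_scaleC_ii)
qed

text \<open>Discriminant argument for the nonnegative quadratic t \<mapsto> \<langle>A (f + t g), f
  + t g\<rangle>, which may degenerate because \<open>A\<close> can have a kernel.\<close>

lemma A_inner_Cauchy_Schwarz:
  assumes "bounded_clinear A" and "positive_op A"
  shows "\<bar>inner (A f) g\<bar> \<le> A_norm A f * A_norm A g"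
proof -
  interpret A: bounded_linear A
    using assms(1) by (rule bounded_clinear_imp_bounded_linear)
  define a b c where "a = inner (A f) f" and "b = inner (A f) g" and "c = inner (A g) g"
  have quad: "0 \<le> a + 2 * b * t + c * t\<^sup>2" for t
    using positive_op_inner_nonneg[OF assms(2), of "f + t *\<^sub>R g"]
      positive_op_inner_commute[OF assms, of g f]
    by (simp add: a_def b_def c_def A.add A.scaleR inner_add_left inner_add_right
        algebra_simps power2_eq_square)
  have "c \<ge> 0"
    using positive_op_inner_nonneg[OF assms(2)] by (simp add: c_def)
  have "b\<^sup>2 \<le> a * c"
  proof (cases "c = 0")
    case True
    have "b = 0"
    proof (rule ccontr)
      assume "b \<noteq> 0"
      \<comment> \<open>At this \<open>t\<close> the affine function \<open>a + 2 * b * t\<close>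
        equals -1.\<close>
      with True quad[of "- (a + 1) / (2 * b)"] show False by simp
    qed
    with True show ?thesis by simp
  next
    case False
    \<comment> \<open>The minimizer of the quadratic.\<close>
    with \<open>c \<ge> 0\<close> quad[of "- b / c"] show ?thesis
      by (simp add: field_simps power2_eq_square)
  qed
  then have "sqrt (b\<^sup>2) \<le> sqrt (a * c)"
    by (rule real_sqrt_le_mono)
  then show ?thesis
    by (simp add: A_norm_eq_sqrt_inner a_def b_def c_def real_sqrt_mult)
qed

text \<open>Formulated for a general pair \<open>T\<close>, \<open>S\<close> so that it can be
  applied again with the roles exchanged.\<close>

lemma A_bounded_by_if_adjoint_pair:
  assumes A: "bounded_clinear A" "positive_op A"
    and dense: "densely_defined T"
    and adj: "\<And>h f. h \<in> dom T \<Longrightarrow> f \<in> dom S \<Longrightarrow>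
      inner (A (the (T h))) f = inner (A h) (the (S f))"
    and bound: "A_bounded_by A T c"
  shows "A_bounded_by A S c"
proof -
  interpret A: bounded_linear A
    using A(1) by (rule bounded_clinear_imp_bounded_linear)
  have "0 \<le> c" using bound by (simp add: A_bounded_by_def)
  have nonneg: "0 \<le> A_norm A f" for f
    by (simp add: A_norm_eq_sqrt_inner positive_op_inner_nonneg[OF A(2)])
  have "A_norm A (the (S f)) \<le> c * A_norm A f" if f: "f \<in> dom S" for f
  proof -
    let ?g = "the (S f)"
    \<comment> \<open>\<open>?g\<close> may lie outside \<open>dom T\<close>, so the estimate is put
      as membership in a set that is closed by continuity of \<open>A\<close>.\<close>
    let ?C = "{h. inner (A h) ?g \<le> c * A_norm A h * A_norm A f}"
    have "dom T \<subseteq> ?C"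
    proof
      fix h assume h: "h \<in> dom T"
      have "inner (A h) ?g = inner (A (the (T h))) f"
        using adj[OF h f] by simp
      also have "\<dots> \<le> A_norm A (the (T h)) * A_norm A f"
        using A_inner_Cauchy_Schwarz[OF A, of "the (T h)" f] by simp
      also have "\<dots> \<le> c * A_norm A h * A_norm A f"
        using bound h nonneg by (auto simp: A_bounded_by_def intro!: mult_right_mono)
      finally show "h \<in> ?C" by simp
    qed
    moreover have "closed ?C"
      unfolding A_norm_eq_sqrt_inner
      by (intro closed_Collect_le continuous_intros A.continuous_on)
    ultimately have "closure (dom T) \<subseteq> ?C" by (rule closure_minimal)
    then have "inner (A ?g) ?g \<le> c * A_norm A ?g * A_norm A f"
      using dense by (auto simp: densely_defined_def)
    then have "A_norm A ?g * A_norm A ?g \<le> A_norm A ?g * (c * A_norm A f)"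
      using positive_op_inner_nonneg[OF A(2), of ?g]
      by (simp add: A_norm_eq_sqrt_inner mult.left_commute mult.assoc)
    \<comment> \<open>Cancel \<open>A_norm A ?g\<close>; if it vanishes, the claim is just
      nonnegativity of the right-hand side.\<close>
    then show ?thesis
      using nonneg[of ?g] nonneg[of f] \<open>0 \<le> c\<close>
      by (cases "A_norm A ?g = 0") (auto simp: mult_le_cancel_left)
  qed
  with \<open>0 \<le> c\<close> show ?thesis by (simp add: A_bounded_by_def)
qed

lemma A_inner_A_adjoint:
  assumes "f \<in> dom (A_adjoint A T)" and "h \<in> dom T"
  shows "A_inner A (the (T h)) f = A_inner A h (the (A_adjoint A T f))"
proof -
  let ?P = "\<lambda>g. g \<in> closure (range A) \<and>
    (\<forall>h\<in>dom T. A_inner A (the (T h)) f = A_inner A h g)"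
  have ex1: "\<exists>!g. ?P g"
    using assms(1) by (auto simp: A_adjoint_def split: if_splits)
  then have "the (A_adjoint A T f) = (THE g. ?P g)"
    by (simp add: A_adjoint_def)
  with theI'[OF ex1] assms(2) show ?thesis by simp
qed

theorem theorem3p9:
  fixes A :: "'a::complex_hilbert_space \<Rightarrow> 'a"
    and T :: "'a \<rightharpoonup> 'a"
  assumes "bounded_clinear A" and "positive_op A"
    and "linear_operator T" and "densely_defined T" and "closable T"
    and "A_adjoint_exists A T"
    and "densely_defined (A_adjoint A T)"
  shows "(A_bounded A T \<longleftrightarrow> A_bounded A (A_adjoint A T)) \<and>
    (A_bounded A T \<longrightarrow> A_bound A T = A_bound A (A_adjoint A T))"
proof -
  note A = assms(1,2)
  have adj: "inner (A (the (T h))) f = inner (A h) (the (A_adjoint A T f))"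
    if "h \<in> dom T" "f \<in> dom (A_adjoint A T)" for h f
    using A_inner_A_adjoint[OF that(2,1)] by (simp add: A_inner_def inner_eq_Re_cinner)
  have adj': "inner (A (the (A_adjoint A T f))) h = inner (A f) (the (T h))"
    if "f \<in> dom (A_adjoint A T)" "h \<in> dom T" for h f
    using adj[OF that(2,1)] positive_op_inner_commute[OF A] by metis
  have "A_bounded_by A T c \<longleftrightarrow> A_bounded_by A (A_adjoint A T) c" for c
    using A_bounded_by_if_adjoint_pair[OF A assms(4) adj]
      A_bounded_by_if_adjoint_pair[OF A assms(7) adj'] by blast
  \<comment> \<open>Both bounds are \<open>LEAST\<close> of the same predicate, hence equal.\<close>
  then show ?thesis by (simp add: A_bounded_def A_bound_def)
qed

end
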